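(* There exists a class of instances (with a credible agent), indexed by the number $n$ of states of nature, where every optimal PIE mechanism has depth $\Omega(n)$. That is, there are a constant $c>0$ and $n_0$ such that for every $n\ge n_0$ the class contains an instance with $|\Theta|=n$ for which every PIE mechanism maximizing the principal's expected payoff over all PIE mechanisms has depth (number of levels of its tree) at least $cn$.
   Context: An instance consists of finite sets $\Theta$ (states), $A$ (actions), $T$ (agent types), a prior $\mu\in\Delta(\Theta)$, a type distribution $\rho\in\Delta(T)$ (zero-probability types are allowed), a principal payoff function $v(\theta,a)$ and agent payoff functions $u_t(\theta,a)$, $t\in T$. The state $\theta\sim\mu$ is observed only by the principal; the agent's type $t\sim\rho$, independent of $\theta$, is known only to the agent. The principal commits to a mechanism; when action $a$ is finally played the principal gets $v(\theta,a)$ and an agent of true type $t$ gets $u_t(\theta,a)$. A PIE (partial information elicitation) mechanism is a finite rooted tree with nodes of the following kinds. For a node $x$ let $T_x\subseteq T$ be the set of types not excluded by the agent's answers at binding elicitation nodes on the path from the root to $x$ ($T_x=T$ at the root). - $\mathsf S$ node (signaling): it carries a strategy $\pi:\Theta\to\Delta(G)$, $G$ finite, and has one child per signal; a signal $g\sim\pi(\cdot\mid\theta)$ is sent and play moves to the child of $g$. - $\mathsf E$ node (binding, possibly partial elicitation): at $x$ the principal presents several subsets of $T_x$ that together cover $T_x$, one per child, and the agent selects one of them as containing his type; $T_c$ of the resulting child $c$ is the selected subset. (Directly asking for the type is the special case of singletons.) - $\widetilde{\mathsf E}$ node (non-binding elicitation): the agent selects one of its children; this imposes no restriction on later behavior.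 - Leaf: the mechanism terminates and the agent plays an action. The agent knows the mechanism and observes the path; his posterior at a node is the Bayesian posterior on $\theta$ given the signals received. The agent is credible: at a leaf $x$ he must play an action that maximizes, under his posterior, the expected payoff of some type in $T_x$, even if this is not his true type. Subject to this, an agent of true type $t$ makes all choices to maximize his expected payoff under $u_t$. Ties are broken as the mechanism decides. *)

theory Defs
  imports "HOL-Probability.Probability_Mass_Function"
begin

record ('s, 'a, 't) persuasion =
  States :: "'s set"
  Actions :: "'a set"
  Types :: "'t set"
  prior :: "'s pmf"
  type_dist :: "'t pmf"
  principal_util :: "'s \<Rightarrow> 'a \<Rightarrow> real"
  agent_util :: "'t \<Rightarrow> 's \<Rightarrow> 'a \<Rightarrow> real"

text \<open>Nonemptiness of the sets of states and types follows from the existence of the two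
  distributions.\<close>

definition valid_instance :: "('s, 'a, 't) persuasion \<Rightarrow> bool" where
  "valid_instance I \<longleftrightarrow>
     finite (States I) \<and> finite (Actions I) \<and> finite (Types I) \<and> Actions I \<noteq> {} \<and>
     set_pmf (prior I) \<subseteq> States I \<and> set_pmf (type_dist I) \<subseteq> Types I"

text \<open>A mechanism tree together with its tie-breaking rule. Every node at which the agent
  chooses is annotated with the choice made by each true type (the action at a leaf, the index of
  the selected child at an elicitation node); the predicate \<open>obedient\<close> below requires these choices
  to be optimal for that type, so that an annotation decides nothing but ties.
  In \<open>Signal \<pi> ms\<close> the signals are the indices of the list \<open>ms\<close>.
  \<open>Elicit\<close> is binding elicitation, each child coming with the subset of types it stands for;
  \<open>Ask\<close> is non-binding elicitation.\<close>

datatype ('s, 'a, 't) pie =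
    Leaf "'t \<Rightarrow> 'a"
  | Signal "'s \<Rightarrow> nat pmf" "('s, 'a, 't) pie list"
  | Elicit "'t \<Rightarrow> nat" "('t set \<times> ('s, 'a, 't) pie) list"
  | Ask "'t \<Rightarrow> nat" "('s, 'a, 't) pie list"

lemma size_mem_pie [termination_simp]:
  fixes ms :: "('s, 'a, 't) pie list"
  shows "m \<in> set ms \<Longrightarrow> size m < Suc (size_list size ms)"
  by (rule le_imp_less_Suc, erule size_list_estimation') simp

lemma size_mem_snd_pie [termination_simp]:
  fixes cs :: "('t set \<times> ('s, 'a, 't) pie) list"
  shows "c \<in> set cs \<Longrightarrow> size (snd c) < Suc (size_list (\<lambda>x. Suc (size (snd x))) cs)"
  by (rule le_imp_less_Suc, erule size_list_estimation') simp

lemma size_nth_pie [termination_simp]: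
  fixes ms :: "('s, 'a, 't) pie list"
  shows "i < length ms \<Longrightarrow> size (ms ! i) < Suc (size_list size ms)"
  by (rule size_mem_pie[OF nth_mem])

lemma size_nth_snd_pie [termination_simp]:
  fixes cs :: "('t set \<times> ('s, 'a, 't) pie) list"
  shows "i < length cs \<Longrightarrow> size (snd (cs ! i)) < Suc (size_list (\<lambda>x. Suc (size (snd x))) cs)"
  by (rule size_mem_snd_pie[OF nth_mem])

text \<open>The number of levels; a single leaf has one.\<close>

fun depth :: "('s, 'a, 't) pie \<Rightarrow> nat" where
  "depth (Leaf act) = 1"
| "depth (Signal \<pi> ms) = Suc (Max (insert 0 ((\<lambda>m. depth m) ` set ms)))"
| "depth (Elicit sel cs) = Suc (Max (insert 0 ((\<lambda>c. depth (snd c)) ` set cs)))"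
| "depth (Ask sel ms) = Suc (Max (insert 0 ((\<lambda>m. depth m) ` set ms)))"

text \<open>The set argument \<open>S\<close> is the set of types not yet excluded. The subsets offered
  at a binding node are nonempty, since no action would be credible at a leaf where all types are
  excluded.\<close>

fun well_formed :: "('s, 'a, 't) persuasion \<Rightarrow> 't set \<Rightarrow> ('s, 'a, 't) pie \<Rightarrow> bool" where
  "well_formed I S (Leaf act) \<longleftrightarrow> True"
| "well_formed I S (Signal \<pi> ms) \<longleftrightarrow>
     (\<forall>\<theta>\<in>States I. set_pmf (\<pi> \<theta>) \<subseteq> {..<length ms}) \<and>
     (\<forall>m\<in>set ms. well_formed I S m)"
| "well_formed I S (Elicit sel cs) \<longleftrightarrow>
     cs \<noteq> [] \<and> (\<forall>c\<in>set cs. fst c \<noteq> {} \<and> fst c \<subseteq> S) \<and> (\<Union>c\<in>set cs. fst c) = S \<and>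
     (\<forall>c\<in>set cs. well_formed I (fst c) (snd c))"
| "well_formed I S (Ask sel ms) \<longleftrightarrow> ms \<noteq> [] \<and> (\<forall>m\<in>set ms. well_formed I S m)"

definition signal_prob ::
  "('s, 'a, 't) persuasion \<Rightarrow> ('s \<Rightarrow> real) \<Rightarrow> ('s \<Rightarrow> nat pmf) \<Rightarrow> nat \<Rightarrow> real" where
  "signal_prob I p \<pi> g = (\<Sum>\<theta>\<in>States I. p \<theta> * pmf (\<pi> \<theta>) g)"

text \<open>After a signal of probability zero the posterior is the zero function
  (division by zero), so that all choices tie below such a signal; the subtree carries weight zero
  in every payoff.\<close>

definition posterior ::
  "('s, 'a, 't) persuasion \<Rightarrow> ('s \<Rightarrow> real) \<Rightarrow> ('s \<Rightarrow> nat pmf) \<Rightarrow> nat \<Rightarrow> 's \<Rightarrow> real" where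
  "posterior I p \<pi> g = (\<lambda>\<theta>. p \<theta> * pmf (\<pi> \<theta>) g / signal_prob I p \<pi> g)"

definition expected ::
  "('s, 'a, 't) persuasion \<Rightarrow> ('s \<Rightarrow> real) \<Rightarrow> ('s \<Rightarrow> 'a \<Rightarrow> real) \<Rightarrow> 'a \<Rightarrow> real" where
  "expected I p w a = (\<Sum>\<theta>\<in>States I. p \<theta> * w \<theta> a)"

definition credible_actions ::
  "('s, 'a, 't) persuasion \<Rightarrow> ('s \<Rightarrow> real) \<Rightarrow> 't set \<Rightarrow> 'a set" where
  "credible_actions I p S =
     {a \<in> Actions I. \<exists>t\<in>S. \<forall>b\<in>Actions I.
        expected I p (agent_util I t) b \<le> expected I p (agent_util I t) a}"

text \<open>\<open>play_value I w t p m\<close> is the expected value of the payoff function \<open>w\<close> (the principal's or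
  an agent's) when play starts at \<open>m\<close> with belief \<open>p\<close> and true type \<open>t\<close>.\<close>

fun play_value ::
  "('s, 'a, 't) persuasion \<Rightarrow> ('s \<Rightarrow> 'a \<Rightarrow> real) \<Rightarrow> 't \<Rightarrow> ('s \<Rightarrow> real) \<Rightarrow> ('s, 'a, 't) pie \<Rightarrow> real"
where
  "play_value I w t p (Leaf act) = expected I p w (act t)"
| "play_value I w t p (Signal \<pi> ms) =
     (\<Sum>g<length ms. signal_prob I p \<pi> g * play_value I w t (posterior I p \<pi> g) (ms ! g))"
| "play_value I w t p (Elicit sel cs) =
     (if sel t < length cs then play_value I w t p (snd (cs ! sel t)) else 0)"
| "play_value I w t p (Ask sel ms) =
     (if sel t < length ms then play_value I w t p (ms ! sel t) else 0)"

text \<open>Optimality is demanded at every node and for every true type, including types in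
  \<open>Types I - S\<close>, which are at the node in question only after a false answer.\<close>

fun obedient ::
  "('s, 'a, 't) persuasion \<Rightarrow> 't set \<Rightarrow> ('s \<Rightarrow> real) \<Rightarrow> ('s, 'a, 't) pie \<Rightarrow> bool"
where
  "obedient I S p (Leaf act) \<longleftrightarrow>
     (\<forall>t\<in>Types I. act t \<in> credible_actions I p S \<and>
        (\<forall>b\<in>credible_actions I p S.
           expected I p (agent_util I t) b \<le> expected I p (agent_util I t) (act t)))"
| "obedient I S p (Signal \<pi> ms) \<longleftrightarrow>
     (\<forall>g<length ms. obedient I S (posterior I p \<pi> g) (ms ! g))"
| "obedient I S p (Elicit sel cs) \<longleftrightarrow>
     (\<forall>t\<in>Types I. sel t < length cs \<and>
        (\<forall>i<length cs. play_value I (agent_util I t) t p (snd (cs ! i))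
           \<le> play_value I (agent_util I t) t p (snd (cs ! sel t)))) \<and>
     (\<forall>i<length cs. obedient I (fst (cs ! i)) p (snd (cs ! i)))"
| "obedient I S p (Ask sel ms) \<longleftrightarrow>
     (\<forall>t\<in>Types I. sel t < length ms \<and>
        (\<forall>i<length ms. play_value I (agent_util I t) t p (ms ! i)
           \<le> play_value I (agent_util I t) t p (ms ! sel t))) \<and>
     (\<forall>i<length ms. obedient I S p (ms ! i))"

definition pie_mechanism :: "('s, 'a, 't) persuasion \<Rightarrow> ('s, 'a, 't) pie \<Rightarrow> bool" where
  "pie_mechanism I m \<longleftrightarrow>
     well_formed I (Types I) m \<and> obedient I (Types I) (pmf (prior I)) m"

definition principal_payoff :: "('s, 'a, 't) persuasion \<Rightarrow> ('s, 'a, 't) pie \<Rightarrow> real" where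
  "principal_payoff I m =
     (\<Sum>t\<in>Types I. pmf (type_dist I) t * play_value I (principal_util I) t (pmf (prior I)) m)"

definition optimal_pie :: "('s, 'a, 't) persuasion \<Rightarrow> ('s, 'a, 't) pie \<Rightarrow> bool" where
  "optimal_pie I m \<longleftrightarrow>
     pie_mechanism I m \<and> (\<forall>m'. pie_mechanism I m' \<longrightarrow> principal_payoff I m' \<le> principal_payoff I m)"

end

theory Submission
  imports Defs
begin

text \<open>There is one real type, and for every action a type of probability zero for which it is dominant.
  Binding elicitation is thus delegation: the agent gives up actions in exchange for information.
  The principal wants the action \<open>Suc \<theta>\<close> in state \<open>\<theta>\<close>, whereas the agent in state \<open>\<theta>\<close> prefers
  the action \<open>\<theta>\<close>, is indifferent among the later ones and dislikes the earlier ones. Under the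
  uniform prior all actions that can be of use are worth exactly as much to the agent as first-best
  play. So as long as the action \<open>\<theta>\<close> is available, the principal cannot change the odds of \<open>\<theta>\<close>
  against the later states, but she needs that action until the state \<open>\<theta> - 1\<close> has been separated.
  Hence the states have to be ruled out one by one. Conversely, giving up the action \<open>k\<close>
  and then learning whether the state is \<open>k\<close>, for \<open>k = 0, 1, \<dots>\<close>, attains the first best, because
  the agent is always indifferent.\<close>

section \<open>Signals, safe actions and first-best play\<close>

lemma signal_prob_nonneg:
  "\<forall>\<theta>\<in>States I. 0 \<le> p \<theta> \<Longrightarrow> 0 \<le> signal_prob I p \<pi> g"
  unfolding signal_prob_def by (intro sum_nonneg mult_nonneg_nonneg) auto

lemma posterior_nonneg:
  "\<forall>\<theta>\<in>States I. 0 \<le> p \<theta> \<Longrightarrow> \<forall>\<theta>\<in>States I. 0 \<le> posterior I p \<pi> g \<theta>"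
  unfolding posterior_def by (auto intro!: divide_nonneg_nonneg mult_nonneg_nonneg signal_prob_nonneg)

text \<open>Bayes' rule free of division. After a signal of probability zero both sides vanish,
  since a zero sum of nonnegative terms has only zero terms.\<close>

lemma signal_prob_mult_posterior:
  assumes "finite (States I)" "\<forall>\<theta>\<in>States I. 0 \<le> p \<theta>" "\<theta> \<in> States I"
  shows "signal_prob I p \<pi> g * posterior I p \<pi> g \<theta> = p \<theta> * pmf (\<pi> \<theta>) g"
proof (cases "signal_prob I p \<pi> g = 0")
  case True
  have "p \<theta> * pmf (\<pi> \<theta>) g = 0"
    using True assms unfolding signal_prob_def
    by (subst (asm) sum_nonneg_eq_0_iff) auto
  then show ?thesis using True by simp
next
  case False
  then show ?thesis by (simp add: posterior_def)
qed

lemma sum_pmf_lessThan: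
  assumes "set_pmf q \<subseteq> {..<L::nat}"
  shows "(\<Sum>g<L. pmf q g) = 1"
  using sum_pmf_eq_1[OF _ assms] by simp

text \<open>The martingale property of beliefs, tested against an arbitrary payoff
  \<open>h\<close>.\<close>

lemma sum_posterior:
  assumes fin: "finite (States I)" and p: "\<forall>\<theta>\<in>States I. 0 \<le> p \<theta>"
    and \<pi>: "\<forall>\<theta>\<in>States I. set_pmf (\<pi> \<theta>) \<subseteq> {..<L}"
  shows "(\<Sum>g<L. signal_prob I p \<pi> g * (\<Sum>\<theta>\<in>States I. posterior I p \<pi> g \<theta> * h \<theta>))
    = (\<Sum>\<theta>\<in>States I. p \<theta> * h \<theta>)"
proof -
  have "(\<Sum>g<L. signal_prob I p \<pi> g * (\<Sum>\<theta>\<in>States I. posterior I p \<pi> g \<theta> * h \<theta>))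
    = (\<Sum>g<L. \<Sum>\<theta>\<in>States I. (p \<theta> * h \<theta>) * pmf (\<pi> \<theta>) g)"
    unfolding sum_distrib_left mult.assoc[symmetric]
    by (intro sum.cong refl) (simp add: signal_prob_mult_posterior[OF fin p])
  also have "\<dots> = (\<Sum>\<theta>\<in>States I. (p \<theta> * h \<theta>) * (\<Sum>g<L. pmf (\<pi> \<theta>) g))"
    by (subst sum.swap) (simp add: sum_distrib_left)
  also have "\<dots> = (\<Sum>\<theta>\<in>States I. p \<theta> * h \<theta>)"
    using \<pi> by (intro sum.cong refl) (simp add: sum_pmf_lessThan)
  finally show ?thesis .
qed

lemma ex_informative_signal:
  assumes fin: "finite (States I)" and p: "\<forall>\<theta>\<in>States I. 0 \<le> p \<theta>"
    and \<pi>: "\<forall>\<theta>\<in>States I. set_pmf (\<pi> \<theta>) \<subseteq> {..<L}" and \<theta>: "\<theta> \<in> States I" "0 < p \<theta>"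
  obtains g where "g < L" "0 < signal_prob I p \<pi> g" "0 < posterior I p \<pi> g \<theta>"
proof -
  obtain g where g: "g \<in> set_pmf (\<pi> \<theta>)"
    using set_pmf_not_empty by fast
  have pos: "0 < p \<theta> * pmf (\<pi> \<theta>) g"
    using g \<theta> by (simp add: pmf_positive)
  then have "0 < signal_prob I p \<pi> g * posterior I p \<pi> g \<theta>"
    using signal_prob_mult_posterior[OF fin p \<theta>(1)] by metis
  then have "0 < signal_prob I p \<pi> g \<and> 0 < posterior I p \<pi> g \<theta>"
    using signal_prob_nonneg[OF p] by (auto simp: zero_less_mult_iff dest: leD)
  then show thesis using that[of g] g \<pi> \<theta>(1) by auto
qed

text \<open>Since the offered subsets cover \<open>S\<close>, the agent can preserve a type \<open>s\<close> with dominant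
  action \<open>a\<close> through all elicitations and play \<open>a\<close> in the end.\<close>

lemma safe_action_le_play_value:
  assumes "finite (States I)" "t \<in> Types I" "a \<in> Actions I" "s \<in> S"
    and dom: "\<forall>\<theta>\<in>States I. \<forall>b\<in>Actions I. agent_util I s \<theta> b \<le> agent_util I s \<theta> a"
    and "\<forall>\<theta>\<in>States I. 0 \<le> p \<theta>" "well_formed I S m" "obedient I S p m"
  shows "expected I p (agent_util I t) a \<le> play_value I (agent_util I t) t p m"
  using assms
proof (induction I S p m rule: obedient.induct)
  case (1 I S p act)
  have "a \<in> credible_actions I p S"
    unfolding credible_actions_def expected_def
    using 1 by (auto intro!: bexI[of _ s] sum_mono mult_left_mono)
  then show ?case using 1 by auto
next
  case (2 I S p \<pi> ms)
  note fin = \<open>finite (States I)\<close> and p = \<open>\<forall>\<theta>\<in>States I. 0 \<le> p \<theta>\<close>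
  have \<pi>: "\<forall>\<theta>\<in>States I. set_pmf (\<pi> \<theta>) \<subseteq> {..<length ms}"
    using "2.prems" by simp
  have "expected I p (agent_util I t) a =
    (\<Sum>g<length ms. signal_prob I p \<pi> g * expected I (posterior I p \<pi> g) (agent_util I t) a)"
    unfolding expected_def using sum_posterior[OF fin p \<pi>] by simp
  also have "\<dots> \<le> play_value I (agent_util I t) t p (Signal \<pi> ms)"
    unfolding play_value.simps
    using "2.prems" posterior_nonneg[OF p] signal_prob_nonneg[OF p]
    by (intro sum_mono mult_left_mono "2.IH") auto
  finally show ?case .
next
  case (3 I S p sel cs)
  obtain i where i: "i < length cs" "s \<in> fst (cs ! i)"
    using "3.prems" by (force simp: in_set_conv_nth)
  have "expected I p (agent_util I t) a \<le> play_value I (agent_util I t) t p (snd (cs ! i))"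
    using "3.prems" i by (intro "3.IH") simp_all
  also have "\<dots> \<le> play_value I (agent_util I t) t p (Elicit sel cs)"
    using "3.prems"(2,8) i(1) by simp
  finally show ?case .
next
  case (4 I S p sel ms)
  have "0 < length ms" using "4.prems" by simp
  then have "expected I p (agent_util I t) a \<le> play_value I (agent_util I t) t p (ms ! 0)"
    using "4.prems" by (intro "4.IH") simp_all
  also have "\<dots> \<le> play_value I (agent_util I t) t p (Ask sel ms)"
    using "4.prems"(2,8) \<open>0 < length ms\<close> by simp
  finally show ?case .
qed

text \<open>The bound is the mass of the belief instead of 1, because the belief after a signal of
  probability zero is the zero function. Equality is what first-best play means below.\<close>

lemma play_value_le_sum:
  assumes "finite (States I)" "t \<in> Types I" "\<forall>\<theta> a. v \<theta> a \<le> (1::real)"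
    and "\<forall>\<theta>\<in>States I. 0 \<le> p \<theta>" "well_formed I S m" "obedient I S p m"
  shows "play_value I v t p m \<le> sum p (States I)"
  using assms
proof (induction I S p m rule: obedient.induct)
  case (1 I S p act)
  then show ?case
    unfolding play_value.simps expected_def by (intro sum_mono) (simp add: mult_left_le)
next
  case (2 I S p \<pi> ms)
  note fin = \<open>finite (States I)\<close> and p = \<open>\<forall>\<theta>\<in>States I. 0 \<le> p \<theta>\<close>
  have \<pi>: "\<forall>\<theta>\<in>States I. set_pmf (\<pi> \<theta>) \<subseteq> {..<length ms}"
    using "2.prems" by simp
  have "play_value I v t p (Signal \<pi> ms) \<le>
    (\<Sum>g<length ms. signal_prob I p \<pi> g * sum (posterior I p \<pi> g) (States I))"
    unfolding play_value.simps
    using "2.prems" posterior_nonneg[OF p] signal_prob_nonneg[OF p]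
    by (intro sum_mono mult_left_mono "2.IH") auto
  also have "\<dots> = sum p (States I)"
    using sum_posterior[OF fin p \<pi>, of "\<lambda>_. 1"] by simp
  finally show ?case .
next
  case (3 I S p sel cs)
  have "sel t < length cs" using "3.prems" by auto
  then have "play_value I v t p (snd (cs ! sel t)) \<le> sum p (States I)"
    using "3.prems" by (intro "3.IH") simp_all
  then show ?case using \<open>sel t < length cs\<close> by simp
next
  case (4 I S p sel ms)
  have "sel t < length ms" using "4.prems" by auto
  then have "play_value I v t p (ms ! sel t) \<le> sum p (States I)"
    using "4.prems" by (intro "4.IH") simp_all
  then show ?case using \<open>sel t < length ms\<close> by simp
qed

text \<open>The shortfalls from the bound after the single signals are nonnegative and their
  weighted sum is 0.\<close>

lemma first_best_signal:
  assumes fin: "finite (States I)" and t: "t \<in> Types I" and v: "\<forall>\<theta> a. v \<theta> a \<le> (1::real)"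
    and p: "\<forall>\<theta>\<in>States I. 0 \<le> p \<theta>"
    and wf: "well_formed I S (Signal \<pi> ms)" and ob: "obedient I S p (Signal \<pi> ms)"
    and fb: "play_value I v t p (Signal \<pi> ms) = sum p (States I)"
    and g: "g < length ms" "signal_prob I p \<pi> g \<noteq> 0"
  shows "play_value I v t (posterior I p \<pi> g) (ms ! g) = sum (posterior I p \<pi> g) (States I)"
proof -
  have \<pi>: "\<forall>\<theta>\<in>States I. set_pmf (\<pi> \<theta>) \<subseteq> {..<length ms}"
    using wf by simp
  let ?gap = "\<lambda>g. signal_prob I p \<pi> g *
    (sum (posterior I p \<pi> g) (States I) - play_value I v t (posterior I p \<pi> g) (ms ! g))"
  have nn: "0 \<le> ?gap g" if "g < length ms" for g
    using that wf ob posterior_nonneg[OF p] signal_prob_nonneg[OF p]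
    by (intro mult_nonneg_nonneg) (auto intro!: play_value_le_sum[OF fin t v])
  have "(\<Sum>g<length ms. ?gap g) = 0"
    using fb sum_posterior[OF fin p \<pi>, of "\<lambda>_. 1"]
    by (simp add: right_diff_distrib sum_subtractf)
  then have "?gap g = 0"
    using nn g(1) by (subst (asm) sum_nonneg_eq_0_iff) auto
  then show ?thesis using g(2) by simp
qed

text \<open>Used with the real type's payoff as \<open>w\<close>: in the chain instances the wanted
  action \<open>Suc \<theta>\<close> gives him 0 in state \<open>\<theta>\<close>, so first-best
  play is worth 0 to him.\<close>

lemma play_value_eq_0_if_first_best:
  assumes "finite (States I)" "t \<in> Types I" "\<forall>\<theta> a. v \<theta> a \<le> (1::real)"
    and "\<forall>\<theta>\<in>States I. \<forall>a. v \<theta> a = 1 \<longrightarrow> w \<theta> a = 0"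
    and "\<forall>\<theta>\<in>States I. 0 \<le> p \<theta>" "well_formed I S m" "obedient I S p m"
    and "play_value I v t p m = sum p (States I)"
  shows "play_value I w t p m = 0"
  using assms
proof (induction I S p m rule: obedient.induct)
  case (1 I S p act)
  have "(\<Sum>\<theta>\<in>States I. p \<theta> * (1 - v \<theta> (act t))) = 0"
    using 1 by (simp add: expected_def right_diff_distrib sum_subtractf)
  then have "\<forall>\<theta>\<in>States I. p \<theta> * (1 - v \<theta> (act t)) = 0"
    using 1 by (subst (asm) sum_nonneg_eq_0_iff) auto
  then have "\<forall>\<theta>\<in>States I. p \<theta> * w \<theta> (act t) = 0"
    using 1 by auto
  then show ?case
    unfolding play_value.simps expected_def by (intro sum.neutral) auto
next
  case (2 I S p \<pi> ms)
  have "signal_prob I p \<pi> g * play_value I w t (posterior I p \<pi> g) (ms ! g) = 0"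
    if "g < length ms" for g
  proof (cases "signal_prob I p \<pi> g = 0")
    case False
    have "play_value I w t (posterior I p \<pi> g) (ms ! g) = 0"
      using "2.prems" that posterior_nonneg[of I p \<pi> g] False
        first_best_signal[of I t v p S \<pi> ms g]
      by (intro "2.IH") auto
    then show ?thesis by simp
  qed simp
  then show ?case
    unfolding play_value.simps by (intro sum.neutral) auto
next
  case (3 I S p sel cs)
  have "sel t < length cs" using "3.prems" by auto
  moreover have "play_value I w t p (snd (cs ! sel t)) = 0"
    using "3.prems" calculation by (intro "3.IH") auto
  ultimately show ?case by simp
next
  case (4 I S p sel ms)
  have "sel t < length ms" using "4.prems" by auto
  moreover have "play_value I w t p (ms ! sel t) = 0"
    using "4.prems" calculation by (intro "4.IH") auto
  ultimately show ?case by simp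
qed

section \<open>The chain instances\<close>

text \<open>Only type \<open>Suc n\<close> has positive probability. A type \<open>t \<le> n\<close> is a commitment device: it makes
  exactly the action \<open>t\<close> credible. The value \<open>n - 1 - \<theta>\<close> makes action \<open>a\<close> worth exactly \<open>0\<close> to the agent when the state is uniform on
  \<open>{a..<n}\<close>.\<close>

definition chain_util :: "nat \<Rightarrow> nat \<Rightarrow> nat \<Rightarrow> real" where
  "chain_util n \<theta> a = (if a < \<theta> then - 1 else if a = \<theta> then real n - 1 - real \<theta> else 0)"

lemma chain_util_simps [simp]:
  "a < \<theta> \<Longrightarrow> chain_util n \<theta> a = - 1"
  "a = \<theta> \<Longrightarrow> chain_util n \<theta> a = real n - 1 - real \<theta>"
  "\<theta> < a \<Longrightarrow> chain_util n \<theta> a = 0"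
  by (auto simp: chain_util_def)

definition chain :: "nat \<Rightarrow> (nat, nat, nat) persuasion" where
  "chain n = \<lparr>States = {..<n}, Actions = {..n}, Types = {..Suc n},
     prior = pmf_of_set {..<n}, type_dist = return_pmf (Suc n),
     principal_util = (\<lambda>\<theta> a. of_bool (a = Suc \<theta>)),
     agent_util = (\<lambda>t. if t = Suc n then chain_util n else (\<lambda>\<theta> a. of_bool (a = t)))\<rparr>"

lemma chain_simps [simp]:
  "States (chain n) = {..<n}" "Actions (chain n) = {..n}" "Types (chain n) = {..Suc n}"
  "prior (chain n) = pmf_of_set {..<n}" "type_dist (chain n) = return_pmf (Suc n)"
  "principal_util (chain n) = (\<lambda>\<theta> a. of_bool (a = Suc \<theta>))"
  "agent_util (chain n) (Suc n) = chain_util n"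
  "t \<le> n \<Longrightarrow> agent_util (chain n) t = (\<lambda>\<theta> a. of_bool (a = t))"
  by (auto simp: chain_def)

lemma valid_chain: "0 < n \<Longrightarrow> valid_instance (chain n)"
  by (auto simp: valid_instance_def set_pmf_of_set lessThan_empty_iff)

lemma principal_payoff_chain:
  "principal_payoff (chain n) m =
    play_value (chain n) (principal_util (chain n)) (Suc n) (pmf (pmf_of_set {..<n})) m"
proof -
  have "principal_payoff (chain n) m = (\<Sum>t\<in>{..Suc n}. if t = Suc n then
    play_value (chain n) (principal_util (chain n)) (Suc n) (pmf (pmf_of_set {..<n})) m else 0)"
    unfolding principal_payoff_def by (intro sum.cong) (auto simp: pmf_return)
  then show ?thesis by simp
qed

section \<open>First-best mechanisms are deep\<close>

abbreviation first_best :: "nat \<Rightarrow> (nat \<Rightarrow> real) \<Rightarrow> (nat, nat, nat) pie \<Rightarrow> bool" where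
  "first_best n p m \<equiv> play_value (chain n) (principal_util (chain n)) (Suc n) p m = sum p {..<n}"

text \<open>One action has to be right in every state of the support, so a first-best leaf serves a
  single state.\<close>

lemma first_best_leaf:
  assumes p: "\<forall>\<theta><n. 0 \<le> p \<theta>" and fb: "first_best n p (Leaf act)" and \<theta>: "\<theta> < n" "0 < p \<theta>"
  shows "act (Suc n) = Suc \<theta>"
proof -
  have "(\<Sum>\<theta><n. p \<theta> * (1 - of_bool (act (Suc n) = Suc \<theta>))) = 0"
    using fb by (simp add: expected_def right_diff_distrib sum_subtractf)
  then have "\<forall>\<theta><n. p \<theta> * (1 - of_bool (act (Suc n) = Suc \<theta>)) = 0"
    using p by (subst (asm) sum_nonneg_eq_0_iff) auto
  then have "p \<theta> * (1 - of_bool (act (Suc n) = Suc \<theta>)) = 0" using \<theta> by blast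
  then show ?thesis using \<theta>(2) by (cases "act (Suc n) = Suc \<theta>") auto
qed

text \<open>Some leaf reached by first-best play has all its belief on \<open>\<theta>\<close>.
  There the action \<open>\<theta>\<close> would pay the real type
  \<open>n - 1 - \<theta> > 0\<close> but \<open>Suc \<theta>\<close> only 0, so the real type must
  be excluded and only type \<open>Suc \<theta>\<close> can make \<open>Suc \<theta>\<close>
  credible. Going down the tree, the set of types only shrinks.\<close>

lemma first_best_type_not_excluded:
  assumes "I = chain n" "\<forall>\<theta><n. 0 \<le> p \<theta>" "S \<subseteq> {..Suc n}"
    and "well_formed I S m" "obedient I S p m"
    and "first_best n p m" and "Suc \<theta> < n" "0 < p \<theta>"
  shows "Suc \<theta> \<in> S"
  using assms
proof (induction I S p m rule: obedient.induct)
  case (1 I S p act)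
  note [simp] = \<open>I = chain n\<close>
  have act: "act (Suc n) = Suc \<theta>'" if "\<theta>' < n" "0 < p \<theta>'" for \<theta>'
    using 1 that by (intro first_best_leaf[of n p]) auto
  have act\<theta>: "act (Suc n) = Suc \<theta>" using act[of \<theta>] 1 by auto
  have p0: "p \<theta>' = 0" if "\<theta>' < n" "\<theta>' \<noteq> \<theta>" for \<theta>'
    using act[of \<theta>'] act\<theta> that 1 by (metis nat.inject order_le_imp_less_or_eq)
  have ex: "expected (chain n) p w a = p \<theta> * w \<theta> a" for w a
    unfolding expected_def using p0 1 by (subst sum.remove[of _ \<theta>]) auto
  have opt: "act (Suc n) \<in> credible_actions I p S"
    "\<forall>b\<in>credible_actions I p S. expected I p (chain_util n) b \<le> expected I p (chain_util n) (Suc \<theta>)"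
    using 1 act\<theta> by force+
  have nS: "Suc n \<notin> S"
  proof
    assume "Suc n \<in> S"
    then have "\<theta> \<in> credible_actions I p S"
      unfolding credible_actions_def using \<open>Suc \<theta> < n\<close> \<open>0 < p \<theta>\<close>
      by (auto intro!: bexI[of _ "Suc n"] simp: ex, auto simp: chain_util_def)
    then have "p \<theta> * (real n - 1 - real \<theta>) \<le> 0"
      using opt(2) by (force simp: ex)
    then show False using \<open>0 < p \<theta>\<close> \<open>Suc \<theta> < n\<close> by (simp add: mult_le_0_iff)
  qed
  obtain t where t: "t \<in> S" "\<forall>b\<in>{..n}. expected I p (agent_util I t) b \<le> expected I p (agent_util I t) (Suc \<theta>)"
    using opt(1) unfolding act\<theta> credible_actions_def by auto
  have "t \<noteq> Suc n" "t \<le> Suc n" using nS t(1) \<open>S \<subseteq> {..Suc n}\<close> by auto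
  then have "t \<le> n" by simp
  \<comment> \<open>A type \<open>t \<le> n\<close> gets the positive amount
    \<open>p \<theta>\<close> from action \<open>t\<close> and 0 from any other.\<close>
  then have "t = Suc \<theta>"
    using t(2)[rule_format, of t] \<open>0 < p \<theta>\<close> by (cases "t = Suc \<theta>") (auto simp: ex)
  then show ?case using t(1) by simp
next
  case (2 I S p \<pi> ms)
  note [simp] = \<open>I = chain n\<close>
  have p: "\<forall>\<theta>\<in>States I. 0 \<le> p \<theta>" using "2.prems" by simp
  have \<pi>: "\<forall>\<theta>\<in>States I. set_pmf (\<pi> \<theta>) \<subseteq> {..<length ms}" using "2.prems" by simp
  obtain g where g: "g < length ms" "0 < signal_prob I p \<pi> g" "0 < posterior I p \<pi> g \<theta>"
    using ex_informative_signal[OF _ p \<pi>, of \<theta>] "2.prems" by auto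
  have "first_best n (posterior I p \<pi> g) (ms ! g)"
    using first_best_signal[of I "Suc n" "principal_util I" p S \<pi> ms g] "2.prems" g by auto
  then show ?case
    using "2.prems" g posterior_nonneg[OF p, of \<pi> g] by (intro "2.IH"[OF g(1)]) auto
next
  case (3 I S p sel cs)
  have s: "sel (Suc n) < length cs" using "3.prems" by auto
  have sub: "fst (cs ! sel (Suc n)) \<subseteq> S" using "3.prems" by auto
  have "fst (cs ! sel (Suc n)) \<subseteq> {..Suc n}" using sub "3.prems"(3) by (rule subset_trans)
  then have "Suc \<theta> \<in> fst (cs ! sel (Suc n))"
    using "3.prems" s by (intro "3.IH"[OF s]) simp_all
  then show ?case using sub by blast
next
  case (4 I S p sel ms)
  have s: "sel (Suc n) < length ms" using "4.prems" by auto
  show ?case using "4.prems" s by (intro "4.IH"[OF s]) auto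
qed

lemma expected_chain_util:
  assumes "a < n"
  shows "expected (chain n) p (chain_util n) a = (real n - 1 - real a) * p a - sum p {a<..<n}"
proof -
  let ?f = "\<lambda>\<theta>. p \<theta> * chain_util n \<theta> a"
  have "{..<n} = insert a ({..<a} \<union> {a<..<n})" using assms by auto
  then have "expected (chain n) p (chain_util n) a = sum ?f (insert a ({..<a} \<union> {a<..<n}))"
    by (simp only: expected_def chain_simps)
  also have "\<dots> = ?f a + sum ?f ({..<a} \<union> {a<..<n})"
    by (rule sum.insert) auto
  also have "sum ?f ({..<a} \<union> {a<..<n}) = sum ?f {..<a} + sum ?f {a<..<n}"
    by (rule sum.union_disjoint) auto
  also have "sum ?f {..<a} = 0"
    by (intro sum.neutral) auto
  also have "sum ?f {a<..<n} = - sum p {a<..<n}"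
    unfolding sum_negf[symmetric] by (intro sum.cong) auto
  finally show ?thesis by (simp add: mult.commute)
qed

text \<open>The equation at \<open>a\<close> says that \<open>q a\<close> is the mean of the later
  values, so backward induction from \<open>n - 1\<close> makes them all equal.\<close>

lemma constant_if_chain_util_eq_0:
  assumes q: "\<And>a. k < a \<Longrightarrow> Suc a < n \<Longrightarrow> expected (chain n) q (chain_util n) a = 0"
    and "k < \<theta>" "\<theta> < n"
  shows "q \<theta> = q (n - 1)"
  using assms(2,3)
proof (induction "n - \<theta>" arbitrary: \<theta> rule: less_induct)
  case less
  show ?case
  proof (cases "Suc \<theta> < n")
    case True
    have "sum q {\<theta><..<n} = (\<Sum>j\<in>{\<theta><..<n}. q (n - 1))"
    proof (rule sum.cong)
      fix j assume "j \<in> {\<theta><..<n}"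
      then show "q j = q (n - 1)"
        using less.prems by (intro less.hyps) auto
    qed simp
    also have "\<dots> = (real n - 1 - real \<theta>) * q (n - 1)"
      using True by (simp add: of_nat_diff)
    finally have "(real n - 1 - real \<theta>) * q \<theta> = (real n - 1 - real \<theta>) * q (n - 1)"
      using q[of \<theta>] expected_chain_util[of \<theta> n q] less.prems True by simp
    moreover have "real n - 1 - real \<theta> \<noteq> 0" using True by linarith
    ultimately show ?thesis by simp
  next
    case False
    then have "\<theta> = n - 1" using less.prems by simp
    then show ?thesis by simp
  qed
qed

text \<open>At a node whose belief has support \<open>{k..<n}\<close>, all the actions \<open>Suc k, \<dots>, n - 1\<close> must
  still be available, each being first-best in the preceding state. If the belief is constant above \<open>k\<close>, then they are all worth \<open>0\<close>, which
  is also the agent's value of first-best play. After no signal can their value exceed \<open>0\<close>, so it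
  stays \<open>0\<close> after each of them, and these equations force the new belief to be constant above \<open>k\<close>,
  too. Hence one signal can at most rule out the state \<open>k\<close>.\<close>

lemma depth_if_first_best:
  assumes "I = chain n" "\<forall>\<theta><n. 0 \<le> p \<theta>" "S \<subseteq> {..Suc n}"
    and "well_formed I S m" "obedient I S p m" "first_best n p m"
    and "k < n" "\<forall>\<theta><k. p \<theta> = 0" "0 < p k"
    and "\<forall>\<theta>. k < \<theta> \<and> \<theta> < n \<longrightarrow> p \<theta> = c" "0 < c"
  shows "n \<le> depth m + k"
  using assms
proof (induction I S p m arbitrary: k c rule: obedient.induct)
  case (1 I S p act)
  have "n \<le> Suc k"
  proof (rule ccontr)
    assume k: "\<not> n \<le> Suc k"
    then have "act (Suc n) = Suc k" "act (Suc n) = Suc (Suc k)"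
      using 1 by (intro first_best_leaf[of n p]; auto)+
    then show False by simp
  qed
  then show ?case by simp
next
  case (2 I S p \<pi> ms)
  note [simp] = \<open>I = chain n\<close>
  show ?case
  proof (cases "n = Suc k")
    case False
    then have k: "Suc k < n" using \<open>k < n\<close> by simp
    have p: "\<forall>\<theta>\<in>States I. 0 \<le> p \<theta>" using "2.prems" by simp
    have \<pi>: "\<forall>\<theta>\<in>States I. set_pmf (\<pi> \<theta>) \<subseteq> {..<length ms}" using "2.prems" by simp
    have fb: "first_best n (posterior I p \<pi> g) (ms ! g)"
      if "g < length ms" "0 < signal_prob I p \<pi> g" for g
      using first_best_signal[of I "Suc n" "principal_util I" p S \<pi> ms g] "2.prems" that by auto
    have wf: "well_formed I S (ms ! g)" and ob: "obedient I S (posterior I p \<pi> g) (ms ! g)"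
      if "g < length ms" for g using "2.prems" that by auto
    have post0: "\<forall>\<theta>\<in>States I. 0 \<le> posterior I p \<pi> g \<theta>" for g
      by (rule posterior_nonneg[OF p])
    have zero: "expected I (posterior I p \<pi> g) (chain_util n) a = 0"
      if g: "g < length ms" "0 < signal_prob I p \<pi> g" and a: "k < a" "Suc a < n" for g a
    proof -
      obtain \<theta> where \<theta>: "a = Suc \<theta>" using a(1) by (cases a) auto
      have "0 < p \<theta>" using "2.prems" \<theta> a by (cases "\<theta> = k") auto
      then have aS: "a \<in> S"
        unfolding \<theta> using "2.prems" \<theta> a by (intro first_best_type_not_excluded[of I n p S "Signal \<pi> ms" \<theta>]) auto
      have le: "expected I (posterior I p \<pi> g) (chain_util n) a \<le> 0"
        if g: "g < length ms" "0 < signal_prob I p \<pi> g" for g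
      proof -
        have "expected I (posterior I p \<pi> g) (agent_util I (Suc n)) a
          \<le> play_value I (agent_util I (Suc n)) (Suc n) (posterior I p \<pi> g) (ms ! g)"
          using aS a wf[OF g(1)] ob[OF g(1)] post0[of g]
          by (intro safe_action_le_play_value[of _ _ _ a S]) auto
        also have "\<dots> = 0"
          using wf[OF g(1)] ob[OF g(1)] post0[of g] fb[OF g]
          by (intro play_value_eq_0_if_first_best[of I "Suc n" "principal_util I" _ _ S])
            auto
        finally show ?thesis by simp
      qed
      have "sum p {a<..<n} = (\<Sum>\<theta>\<in>{a<..<n}. c)" using "2.prems" a by (intro sum.cong) auto
      then have "expected I p (chain_util n) a = 0"
        using expected_chain_util[of a n p] "2.prems" a by (simp add: of_nat_diff)
      then have "(\<Sum>g<length ms. - (signal_prob I p \<pi> g * expected I (posterior I p \<pi> g) (chain_util n) a)) = 0"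
        unfolding expected_def using sum_posterior[OF _ p \<pi>] by (simp add: sum_negf)
      moreover have "0 \<le> - (signal_prob I p \<pi> g * expected I (posterior I p \<pi> g) (chain_util n) a)"
        if "g < length ms" for g
        using le[OF that] signal_prob_nonneg[OF p, of \<pi> g]
        by (cases "signal_prob I p \<pi> g = 0") (auto simp: mult_le_0_iff)
      ultimately have "signal_prob I p \<pi> g * expected I (posterior I p \<pi> g) (chain_util n) a = 0"
        using g(1) by (subst (asm) sum_nonneg_eq_0_iff) auto
      then show ?thesis using g(2) by simp
    qed
    \<comment> \<open>A signal that keeps the last state possible makes the new constant above
      \<open>k\<close> positive, as the induction hypothesis requires.\<close>
    have "0 < p (n - 1)" using "2.prems" k by auto
    then obtain g where g: "g < length ms" "0 < signal_prob I p \<pi> g" "0 < posterior I p \<pi> g (n - 1)"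
      using ex_informative_signal[OF _ p \<pi>, of "n - 1"] k by auto
    let ?q = "posterior I p \<pi> g"
    have const: "\<forall>\<theta>. k < \<theta> \<and> \<theta> < n \<longrightarrow> ?q \<theta> = ?q (n - 1)"
      using constant_if_chain_util_eq_0[of k n ?q] zero[OF g(1,2)] by auto
    have low: "\<forall>\<theta><k. ?q \<theta> = 0" using "2.prems" by (auto simp: posterior_def)
    have "\<forall>\<theta><n. 0 \<le> ?q \<theta>" using post0[of g] by simp
    note q = \<open>I = chain n\<close> this \<open>S \<subseteq> {..Suc n}\<close> wf[OF g(1)] ob[OF g(1)] fb[OF g(1,2)]
    have child: "n \<le> depth (ms ! g) + Suc k"
    \<comment> \<open>If the signal rules out \<open>k\<close>, the support now starts at
      \<open>Suc k\<close>; otherwise it still starts at \<open>k\<close> and the bound is even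
      better by one.\<close>
    proof (cases "?q k = 0")
      case True
      have "\<forall>\<theta><Suc k. ?q \<theta> = 0" using True low by (simp add: less_Suc_eq)
      moreover have "?q (Suc k) = ?q (n - 1)" using const k by blast
      then have "0 < ?q (Suc k)" using g(3) by simp
      moreover have "\<forall>\<theta>. Suc k < \<theta> \<and> \<theta> < n \<longrightarrow> ?q \<theta> = ?q (n - 1)"
        using const Suc_lessD by blast
      ultimately show ?thesis by (rule "2.IH"[OF g(1) q k _ _ _ g(3)])
    next
      case False
      then have "0 < ?q k" using post0[of g] k by (simp add: order_less_le)
      then have "n \<le> depth (ms ! g) + k"
        using const by (rule "2.IH"[OF g(1) q \<open>k < n\<close> low _ _ g(3)])
      then show ?thesis by simp
    qed
    have "depth (ms ! g) \<le> Max (insert 0 (depth ` set ms))"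
      using g(1) by (intro Max_ge) auto
    then show ?thesis using child by simp
  qed simp
next
  case (3 I S p sel cs)
  have s: "sel (Suc n) < length cs" using "3.prems" by auto
  have "fst (cs ! sel (Suc n)) \<subseteq> S" using "3.prems" by auto
  then have "fst (cs ! sel (Suc n)) \<subseteq> {..Suc n}" using "3.prems"(3) by (rule subset_trans)
  then have "n \<le> depth (snd (cs ! sel (Suc n))) + k"
    using "3.prems" s by (intro "3.IH"[OF s, of k c]) simp_all
  moreover have "depth (snd (cs ! sel (Suc n))) \<le> Max (insert 0 ((\<lambda>c. depth (snd c)) ` set cs))"
    using s by (intro Max_ge) auto
  ultimately show ?case by simp
next
  case (4 I S p sel ms)
  have s: "sel (Suc n) < length ms" using "4.prems" by auto
  have "n \<le> depth (ms ! sel (Suc n)) + k"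
    using "4.prems" s by (intro "4.IH"[OF s, of k c]) simp_all
  moreover have "depth (ms ! sel (Suc n)) \<le> Max (insert 0 (depth ` set ms))"
    using s by (intro Max_ge) auto
  ultimately show ?case by simp
qed

section \<open>A first-best mechanism\<close>

lemma ex_maximizer:
  fixes f :: "'b \<Rightarrow> real"
  assumes "finite A" "A \<noteq> {}"
  shows "\<exists>a\<in>A. \<forall>b\<in>A. f b \<le> f a"
proof -
  have "Max (f ` A) \<in> f ` A" using assms by (intro Max_in) auto
  then obtain a where "a \<in> A" "f a = Max (f ` A)" by force
  then show ?thesis using assms(1) by (intro bexI[of _ a]) auto
qed

lemma credible_actions_nonempty:
  assumes "finite (Actions I)" "Actions I \<noteq> {}" "S \<noteq> {}"
  shows "credible_actions I p S \<noteq> {}"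
proof -
  obtain s where s: "s \<in> S" using assms by auto
  obtain a where "a \<in> Actions I"
    "\<forall>b\<in>Actions I. expected I p (agent_util I s) b \<le> expected I p (agent_util I s) a"
    using ex_maximizer[OF assms(1,2)] by blast
  then have "a \<in> credible_actions I p S"
    unfolding credible_actions_def using s by auto
  then show ?thesis by auto
qed

text \<open>Obedience concerns every type: the tie of \<open>t\<close> is broken toward
  \<open>a\<close>, and all others get arbitrary maximizers.\<close>

lemma ex_obedient_leaf:
  assumes "finite (Actions I)" "a \<in> credible_actions I p S"
    and "\<forall>b\<in>credible_actions I p S. expected I p (agent_util I t) b \<le> expected I p (agent_util I t) a"
  obtains act where "act t = a" "obedient I S p (Leaf act)"
proof -
  let ?C = "credible_actions I p S"
  have "finite ?C" using assms(1) by (simp add: credible_actions_def)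
  have "\<exists>b\<in>?C. \<forall>b'\<in>?C. expected I p (agent_util I s) b' \<le> expected I p (agent_util I s) b" for s
    using \<open>finite ?C\<close> assms(2) by (intro ex_maximizer) auto
  then obtain best where
    "\<forall>s. best s \<in> ?C \<and> (\<forall>b\<in>?C. expected I p (agent_util I s) b \<le> expected I p (agent_util I s) (best s))"
    by metis
  then have "obedient I S p (Leaf (best(t := a)))" using assms by auto
  then show thesis using that[of "best(t := a)"] by simp
qed

text \<open>With the real type excluded, each remaining type \<open>t\<close> has \<open>t\<close>
  as its only best action, because the belief has positive mass.\<close>

lemma credible_actions_chain:
  assumes "S \<subseteq> {..n}" "0 < sum p {..<n}" "a \<in> credible_actions (chain n) p S"
  shows "a \<in> S"
proof -
  obtain t where t: "t \<in> S" "\<forall>b\<le>n. expected (chain n) p (agent_util (chain n) t) b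
      \<le> expected (chain n) p (agent_util (chain n) t) a"
    using assms(3) by (auto simp: credible_actions_def)
  have "t \<le> n" using t(1) assms(1) by auto
  then have "t = a"
    using t(2)[rule_format, of t] assms(2) by (cases "t = a") (auto simp: expected_def)
  then show ?thesis using t(1) by simp
qed

lemma credible_actions_chainI:
  assumes "a \<in> S" "a \<le> n" "\<forall>\<theta><n. 0 \<le> p \<theta>"
  shows "a \<in> credible_actions (chain n) p S"
  unfolding credible_actions_def expected_def
  using assms by (auto intro!: bexI[of _ a] sum_mono mult_left_mono)

text \<open>In state \<open>\<theta>\<close> only action \<open>\<theta>\<close> can pay the real
  type more than 0, and it is either given up or, for \<open>\<theta> = n - 1\<close>, worth 0 too.
  So \<open>Suc \<theta>\<close> is among his best credible actions.\<close>

lemma ex_first_best_leaf: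
  assumes "\<theta> < n" "S \<subseteq> {\<theta>..n}" "Suc \<theta> \<in> S" "Suc \<theta> < n \<longrightarrow> \<theta> \<notin> S"
  defines "p \<equiv> \<lambda>\<theta>'. of_bool (\<theta>' = \<theta>)"
  obtains m where "well_formed (chain n) S m" "obedient (chain n) S p m" "first_best n p m"
proof -
  have ex: "expected (chain n) p w a = w \<theta> a" for w a
    unfolding expected_def p_def using assms(1) by (subst sum.remove[of _ \<theta>]) auto
  have "sum p {..<n} = 1"
    unfolding p_def using assms(1) by (subst sum.remove[of _ \<theta>]) auto
  have "chain_util n \<theta> b \<le> 0" if "b \<in> credible_actions (chain n) p S" for b
  proof -
    have "b \<in> S"
      using assms(2) \<open>sum p {..<n} = 1\<close> that by (intro credible_actions_chain[of S n p]) auto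
    then show ?thesis using assms by (cases "b = \<theta>") (auto simp: chain_util_def)
  qed
  moreover have "Suc \<theta> \<in> credible_actions (chain n) p S"
    using assms by (intro credible_actions_chainI) auto
  ultimately obtain act where "act (Suc n) = Suc \<theta>" "obedient (chain n) S p (Leaf act)"
    using ex_obedient_leaf[of "chain n" "Suc \<theta>" p S "Suc n"] by (auto simp: ex)
  then show thesis
    using that[of "Leaf act"] \<open>sum p {..<n} = 1\<close> by (simp add: ex)
qed

text \<open>The agent pays for continuing with \<open>m\<close> by giving up the type \<open>s\<close>; the alternative is to be
  bound to \<open>s\<close> without any further information.\<close>

lemma ex_first_best_elicit:
  assumes m: "well_formed (chain n) S m" "obedient (chain n) S p m" "first_best n p m"
    and p: "\<forall>\<theta><n. 0 \<le> p \<theta>" and S: "S \<noteq> {}"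
    and bad: "\<forall>a\<le>n. expected (chain n) p (chain_util n) a \<le> 0"
  obtains m' where "well_formed (chain n) (insert s S) m'" "obedient (chain n) (insert s S) p m'"
    "first_best n p m'"
proof -
  let ?I = "chain n"
  have "credible_actions ?I p {s} \<noteq> {}" by (intro credible_actions_nonempty) auto
  moreover have "finite (credible_actions ?I p {s})" by (simp add: credible_actions_def)
  ultimately obtain a where a: "a \<in> credible_actions ?I p {s}"
    "\<forall>b\<in>credible_actions ?I p {s}. expected ?I p (chain_util n) b \<le> expected ?I p (chain_util n) a"
    using ex_maximizer[of "credible_actions ?I p {s}" "expected ?I p (chain_util n)"] by blast
  obtain act where act: "act (Suc n) = a" "obedient ?I {s} p (Leaf act)"
    by (rule ex_obedient_leaf[of ?I a p "{s}" "Suc n"]) (use a in auto)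
  define val where "val t m = play_value ?I (agent_util ?I t) t p m" for t m
  \<comment> \<open>Index 0 is the continuation \<open>m\<close>. Ties go to it, so the real type,
    who gets 0 there and at most 0 at the alternative, selects it.\<close>
  define sel where "sel t = (if val t (Leaf act) \<le> val t m then 0 else 1::nat)" for t
  let ?m = "Elicit sel [(S, m), ({s}, Leaf act)]"
  have "val (Suc n) m = 0"
    unfolding val_def using m p
    by (intro play_value_eq_0_if_first_best[of ?I "Suc n" "principal_util ?I" _ _ S]) auto
  moreover have "a \<le> n" using a by (simp add: credible_actions_def)
  then have "val (Suc n) (Leaf act) \<le> 0" using bad act by (simp add: val_def)
  ultimately have "sel (Suc n) = 0" by (simp add: sel_def)
  then have "first_best n p ?m" using m by simp
  moreover have "well_formed ?I (insert s S) ?m" using m S by auto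
  moreover have "obedient ?I (insert s S) p ?m"
    using m act unfolding obedient.simps val_def[symmetric]
    by (auto simp: sel_def less_Suc_eq)
  ultimately show thesis by (intro that)
qed

definition uniform_from :: "nat \<Rightarrow> nat \<Rightarrow> nat \<Rightarrow> real" where
  "uniform_from n k \<theta> = (if k \<le> \<theta> \<and> \<theta> < n then 1 / (real n - real k) else 0)"

lemma uniform_from_nonneg: "0 \<le> uniform_from n k \<theta>"
  by (auto simp: uniform_from_def)

lemma sum_uniform_from: "k \<le> a \<Longrightarrow> a \<le> n \<Longrightarrow> sum (uniform_from n k) {a..<n} = (real n - real a) / (real n - real k)"
  by (simp add: uniform_from_def of_nat_diff)

text \<open>For \<open>k \<le> a < n\<close> gain and losses cancel; an action below
  \<open>k\<close> is too early in every possible state, and the action \<open>n\<close> always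
  yields 0.\<close>

lemma expected_uniform_from_le_0:
  assumes "a \<le> n"
  shows "expected (chain n) (uniform_from n k) (chain_util n) a \<le> 0"
proof (cases "a < n")
  case True
  show ?thesis
  proof (cases "k \<le> a")
    case le: True
    have "sum (uniform_from n k) {a<..<n} = (real n - 1 - real a) / (real n - real k)"
      using sum_uniform_from[of k "Suc a" n] True le by (simp add: atLeastSucLessThan_greaterThanLessThan diff_diff_eq)
    then show ?thesis using True le by (simp add: expected_chain_util uniform_from_def[of n k a])
  next
    case False
    then show ?thesis
      using True by (simp add: expected_chain_util uniform_from_def[of n k a] sum_nonneg uniform_from_nonneg)
  qed
next
  case False
  then have "expected (chain n) (uniform_from n k) (chain_util n) a = 0"
    unfolding expected_def by (intro sum.neutral) auto
  then show ?thesis by simp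
qed

lemma ex_first_best_uniform:
  assumes "k < n"
  shows "\<exists>m. well_formed (chain n) {k..n} m \<and> obedient (chain n) {k..n} (uniform_from n k) m
    \<and> first_best n (uniform_from n k) m"
  using assms
proof (induction "n - k" arbitrary: k rule: less_induct)
  case less
  let ?I = "chain n" and ?p = "uniform_from n k"
  show ?case
  proof (cases "Suc k < n")
    case False
    \<comment> \<open>In the last state action \<open>k\<close> pays 0 as well, so type
      \<open>k\<close> may stay.\<close>
    then have n: "n = Suc k" using less.prems by simp
    have p: "?p = (\<lambda>\<theta>. of_bool (\<theta> = k))" by (auto simp: uniform_from_def n fun_eq_iff)
    show ?thesis
      unfolding p by (rule ex_first_best_leaf[of k n "{k..n}"]) (use n in auto)
  next
    case True
    have "n - Suc k < n - k" using True by linarith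
    then obtain m where m: "well_formed ?I {Suc k..n} m"
      "obedient ?I {Suc k..n} (uniform_from n (Suc k)) m" "first_best n (uniform_from n (Suc k)) m"
      using less.hyps[of "Suc k"] True by blast
    obtain l where l: "well_formed ?I {Suc k..n} l"
      "obedient ?I {Suc k..n} (\<lambda>\<theta>. of_bool (\<theta> = k)) l" "first_best n (\<lambda>\<theta>. of_bool (\<theta> = k)) l"
      by (rule ex_first_best_leaf[of k n "{Suc k..n}"]) (use True in auto)
    define \<pi> :: "nat \<Rightarrow> nat pmf" where "\<pi> \<theta> = return_pmf (if \<theta> = k then 0 else 1)" for \<theta>
    let ?m = "Signal \<pi> [l, m]"
    have "signal_prob ?I ?p \<pi> 0 = (\<Sum>\<theta><n. if \<theta> = k then ?p k else 0)"
      unfolding signal_prob_def chain_simps by (intro sum.cong) (auto simp: \<pi>_def)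
    then have s0: "signal_prob ?I ?p \<pi> 0 = 1 / (real n - real k)"
      using True by (simp add: uniform_from_def)
    have "signal_prob ?I ?p \<pi> 1 = sum ?p {Suc k..<n}"
      unfolding signal_prob_def chain_simps
      by (intro sum.mono_neutral_cong_right) (auto simp: \<pi>_def uniform_from_def)
    then have s1: "signal_prob ?I ?p \<pi> 1 = (real n - real (Suc k)) / (real n - real k)"
      using sum_uniform_from[of k "Suc k" n] True by simp
    have q0: "posterior ?I ?p \<pi> 0 = (\<lambda>\<theta>. of_bool (\<theta> = k))"
      unfolding posterior_def s0 using True by (auto simp: \<pi>_def uniform_from_def fun_eq_iff)
    have q1: "posterior ?I ?p \<pi> 1 = uniform_from n (Suc k)"
      unfolding posterior_def s1 using True by (auto simp: \<pi>_def uniform_from_def fun_eq_iff)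
    have \<pi>: "\<forall>\<theta>\<in>States ?I. set_pmf (\<pi> \<theta>) \<subseteq> {..<2}" by (auto simp: \<pi>_def)
    have "{..<2::nat} = {0, 1}" by auto
    then have fb: "first_best n ?p ?m"
      using sum_posterior[OF _ _ \<pi>, of ?p "\<lambda>_. 1"] m(3) l(3) q0 q1
      by (simp add: uniform_from_nonneg numeral_2_eq_2)
    have wf: "well_formed ?I {Suc k..n} ?m" using m l \<pi> by (auto simp: numeral_2_eq_2)
    have ob: "obedient ?I {Suc k..n} ?p ?m" using m l q0 q1 by (auto simp: less_Suc_eq)
    \<comment> \<open>The elicitation has to precede the signal: under the uniform belief no
      uninformed action is worth more than 0, whereas an agent who knew that the state is
      \<open>k\<close> would not give up action \<open>k\<close>.\<close>
    obtain m' where "well_formed ?I (insert k {Suc k..n}) m'"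
      "obedient ?I (insert k {Suc k..n}) ?p m'" "first_best n ?p m'"
      by (rule ex_first_best_elicit[OF wf ob fb, of k])
        (use True expected_uniform_from_le_0 uniform_from_nonneg in auto)
    moreover have "insert k {Suc k..n} = {k..n}" using True by auto
    ultimately show ?thesis by metis
  qed
qed

section \<open>Optimal mechanisms of the chain instances are first-best\<close>

lemma prior_chain:
  assumes "0 < n"
  shows "pmf (pmf_of_set {..<n}) = uniform_from n 0"
  using assms by (auto simp: fun_eq_iff uniform_from_def indicator_def lessThan_empty_iff)

lemma principal_payoff_chain_le_1:
  assumes "0 < n" "pie_mechanism (chain n) m"
  shows "principal_payoff (chain n) m \<le> 1"
proof -
  have "principal_payoff (chain n) m \<le> sum (pmf (pmf_of_set {..<n})) {..<n}"
    unfolding principal_payoff_chain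
    using play_value_le_sum[of "chain n" "Suc n" "principal_util (chain n)" _ "{..Suc n}" m] assms
    by (auto simp: pie_mechanism_def)
  also have "\<dots> = 1" using assms(1) by (intro sum_pmf_eq_1) (auto simp: lessThan_empty_iff)
  finally show ?thesis .
qed

lemma ex_first_best_chain:
  assumes "0 < n"
  obtains m where "pie_mechanism (chain n) m" "principal_payoff (chain n) m = 1"
proof -
  obtain m where m: "well_formed (chain n) {0..n} m" "obedient (chain n) {0..n} (uniform_from n 0) m"
    "first_best n (uniform_from n 0) m"
    using ex_first_best_uniform[OF assms] by blast
  \<comment> \<open>At the root the agent gives up his own true type, which leaves only the
    commitment types.\<close>
  obtain m' where m': "well_formed (chain n) (insert (Suc n) {0..n}) m'"
    "obedient (chain n) (insert (Suc n) {0..n}) (uniform_from n 0) m'" "first_best n (uniform_from n 0) m'"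
    by (rule ex_first_best_elicit[OF m, of "Suc n"])
      (use expected_uniform_from_le_0 uniform_from_nonneg in auto)
  have "insert (Suc n) {0..n} = {..Suc n}" by auto
  then have "pie_mechanism (chain n) m'"
    using m' assms by (simp add: pie_mechanism_def prior_chain)
  moreover have "principal_payoff (chain n) m' = 1"
    using m'(3) assms sum_uniform_from[of 0 0 n]
    by (simp add: principal_payoff_chain prior_chain atLeast0LessThan)
  ultimately show thesis by (rule that)
qed

theorem theorem16:
  "\<exists>(I :: nat \<Rightarrow> (nat, nat, nat) persuasion) (c :: real) (n0 :: nat). c > 0 \<and>
     (\<forall>n\<ge>n0. valid_instance (I n) \<and> card (States (I n)) = n \<and>
        (\<exists>m. optimal_pie (I n) m) \<and>
        (\<forall>m. optimal_pie (I n) m \<longrightarrow> c * real n \<le> real (depth m)))"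
proof (intro exI[of _ chain] exI[of _ "1::real"] exI[of _ "1::nat"] conjI allI impI)
  fix n :: nat assume "1 \<le> n"
  then have n: "0 < n" by simp
  show "valid_instance (chain n)" by (rule valid_chain[OF n])
  show "card (States (chain n)) = n" by simp
  obtain m where m: "pie_mechanism (chain n) m" "principal_payoff (chain n) m = 1"
    using ex_first_best_chain[OF n] .
  then show "\<exists>m. optimal_pie (chain n) m"
    using principal_payoff_chain_le_1[OF n] by (auto simp: optimal_pie_def)
  fix m' assume "optimal_pie (chain n) m'"
  then have m': "pie_mechanism (chain n) m'" "principal_payoff (chain n) m' = 1"
    using m principal_payoff_chain_le_1[OF n, of m'] by (auto simp: optimal_pie_def)
  have "first_best n (uniform_from n 0) m'"
    using m'(2) n sum_uniform_from[of 0 0 n]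
    by (simp add: principal_payoff_chain prior_chain atLeast0LessThan)
  \<comment> \<open>The prior fits the depth bound with \<open>k = 0\<close> and constant
    \<open>1 / n\<close>, which gives the linear factor 1.\<close>
  then have "n \<le> depth m' + 0"
    using m'(1) n uniform_from_nonneg
    by (intro depth_if_first_best[of "chain n" n "uniform_from n 0" "{..Suc n}" m' 0 "1 / real n"])
      (auto simp: pie_mechanism_def prior_chain, auto simp: uniform_from_def)
  then show "1 * real n \<le> real (depth m')" by simp
qed simp

end
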